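(* Let $A\in\mathbb{R}^{m\times m}$ and $W\in\mathbb{R}^{m\times m}$ be symmetric positive definite, let $b\in\mathbb{R}^m$, and let $w^*$ be a solution of $Aw=b$. Let $\mathcal{D}$ be a distribution over matrices in $\mathbb{R}^{m\times\tau}$ and let $S_0,S_1,S_2,\ldots$ be sampled i.i.d. from $\mathcal{D}$. Let $(\eta_k)_{k\ge 0}$ be a sequence of parameters with $0<\eta_k<1$, and let $$\zeta_0=0\quad\text{and}\quad \zeta_k=\frac{1}{\eta_k}\sum_{t=0}^{k-1}\eta_t(1-\eta_t)\quad\text{for all }k\ge 1.$$ Let $w^0\in\mathbb{R}^m$, $w^{-1}=w^0$, $z^{-1}=w^0$, and for $k\ge 0$ let $$z^k=z^{k-1}-\eta_k\nabla_W f_{S_k}(w^k),\qquad w^{k+1}=\left(1-\frac{1}{\zeta_{k+1}+1}\right)w^k+\frac{1}{\zeta_{k+1}+1}z^k.$$ Then for every $k\ge 0$, $$\mathbb{E}\left[\|Aw^k-b\|^2\right]\le\frac{1}{\lambda_{\min}(\mathbb{E}[H_S])}\,\frac{\|w^0-w^*\|_W^2}{\sum_{t=0}^{k}\eta_t(1-\eta_t)}.$$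
   Context: Norms: $\|\cdot\|$ is the Euclidean norm and $\|x\|_W=\sqrt{\langle x,Wx\rangle}$. For $S\in\mathbb{R}^{m\times\tau}$ define $$H_S := S\,(S^\top A W^{-1} A S)^{\dagger}S^\top,\qquad f_S(w):=\tfrac12 (Aw-b)^\top H_S(Aw-b),\qquad \nabla_W f_S(w):=W^{-1}AH_S(Aw-b),$$ where $\dagger$ is the Moore–Penrose pseudoinverse ($\nabla_W f_S$ is the gradient of $f_S$ relative to the inner product $\langle x,y\rangle_W=\langle Wx,y\rangle$). $\mathbb{E}[H_S]$ is the expectation over $S\sim\mathcal{D}$, and $\lambda_{\min}$ denotes the smallest eigenvalue. The right-hand side of the bound is read as $+\infty$ if $\lambda_{\min}(\mathbb{E}[H_S])=0$. *)

theory Defs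
  imports "HOL-Probability.Probability"
begin

definition sym_pos_def :: "real^'n^'n \<Rightarrow> bool" where
  "sym_pos_def M \<longleftrightarrow> transpose M = M \<and> (\<forall>x. x \<noteq> 0 \<longrightarrow> 0 < x \<bullet> (M *v x))"

definition wnorm :: "real^'n^'n \<Rightarrow> real^'n \<Rightarrow> real" where
  "wnorm W x = sqrt (x \<bullet> (W *v x))"

(* The four Penrose equations, which have exactly one solution for every real matrix. *)
definition is_pinv :: "real^'n^'m \<Rightarrow> real^'m^'n \<Rightarrow> bool" where
  "is_pinv M X \<longleftrightarrow>
     M ** X ** M = M \<and> X ** M ** X = X \<and>
     transpose (M ** X) = M ** X \<and> transpose (X ** M) = X ** M"

definition pinv :: "real^'n^'m \<Rightarrow> real^'m^'n" where
  "pinv M = (THE X. is_pinv M X)"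

definition eigenvalues :: "real^'n^'n \<Rightarrow> real set" where
  "eigenvalues M = {l. \<exists>v. v \<noteq> 0 \<and> M *v v = l *\<^sub>R v}"

(* Only used for symmetric M, whose set of (real) eigenvalues is finite and nonempty. *)
definition lambda_min :: "real^'n^'n \<Rightarrow> real" where
  "lambda_min M = Min (eigenvalues M)"

definition H_mat :: "real^'m^'m \<Rightarrow> real^'m^'m \<Rightarrow> real^'t^'m \<Rightarrow> real^'m^'m" where
  "H_mat A W S =
     S ** pinv (transpose S ** A ** matrix_inv W ** A ** S) ** transpose S"

definition f_loss :: "real^'m^'m \<Rightarrow> real^'m^'m \<Rightarrow> real^'m \<Rightarrow> real^'t^'m \<Rightarrow> real^'m \<Rightarrow> real" where
  "f_loss A W b S w = 1/2 * ((A *v w - b) \<bullet> (H_mat A W S *v (A *v w - b)))"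

(* The gradient of f_loss A W b S relative to the inner product (x, y) \<mapsto> (W *v x) \<bullet> y. *)
definition grad_f :: "real^'m^'m \<Rightarrow> real^'m^'m \<Rightarrow> real^'m \<Rightarrow> real^'t^'m \<Rightarrow> real^'m \<Rightarrow> real^'m" where
  "grad_f A W b S w = (matrix_inv W ** A ** H_mat A W S) *v (A *v w - b)"

(* A distribution D on m x t matrices is a Borel probability measure.  The Bochner integral is
   taken in the space of matrices; it is a proper one, since H_mat A W is Borel measurable and
   bounded when A and W are symmetric positive definite. *)
definition expected_H :: "real^'m^'m \<Rightarrow> real^'m^'m \<Rightarrow> (real^'t^'m) measure \<Rightarrow> real^'m^'m" where
  "expected_H A W D = (\<integral>S. H_mat A W S \<partial>D)"

end

(* Write V(y) = |y - w*|_W^2, r^k = A w^k - b and s_k = sum_{t<k} eta_t (1 - eta_t) = eta_k zeta_k.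
   The identity H_S A W^-1 A H_S = H_S gives |grad_W f_S(w)|_W^2 = 2 f_S(w), and the averaging step
   rewrites as z^{k-1} = w^k + zeta_k (w^k - w^{k-1}).  Expanding V(z^k) and using convexity of
   f_{S_k}, and then that S_k is independent of w^k and w^{k-1}, shows that
   E V(z^k) + s_{k+1} E <r^k, E[H_S] r^k> does not increase with k.  Since
   <r, E[H_S] r> >= lambda_min(E[H_S]) |r|^2, the bound follows.

   If S |-> H_S were not integrable, the Bochner integral E[H_S] would be 0 and the right-hand side
   infinite; this is why measurability of the pseudoinverse is never needed. *)

theory Submission
  imports Defs
begin

subsection \<open>Pseudoinverses and extreme eigenvalues of symmetric matrices\<close>

lemma inner_transpose_mult:
  fixes A :: "real^'n^'m"
  shows "x \<bullet> (transpose A *v y) = (A *v x) \<bullet> y"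
  by (metis dot_lmul_matrix inner_commute transpose_matrix_vector)

lemma symmetric_matrix_iff:
  fixes M :: "real^'n^'n"
  shows "transpose M = M \<longleftrightarrow> (\<forall>x y. x \<bullet> (M *v y) = (M *v x) \<bullet> y)"
proof
  assume R: "\<forall>x y. x \<bullet> (M *v y) = (M *v x) \<bullet> y"
  have "transpose M *v y = M *v y" for y
    by (rule vector_eq_rdot[THEN iffD1]) (metis R inner_commute inner_transpose_mult)
  then show "transpose M = M"
    by (simp add: matrix_eq)
qed (metis inner_transpose_mult)

text \<open>Symmetry of the products gives \<open>M X = (M Y M X)^T = M X M Y = M Y\<close>, and in
  the same way \<open>X M = Y M\<close>. Hence \<open>X = X M X = Y M X = Y M Y = Y\<close>.\<close>

lemma is_pinv_unique:
  assumes X: "is_pinv M X" and Y: "is_pinv M Y"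
  shows "X = Y"
proof -
  have x: "M ** X ** M = M" "X ** M ** X = X"
      "transpose (M ** X) = M ** X" "transpose (X ** M) = X ** M"
    and y: "M ** Y ** M = M" "Y ** M ** Y = Y"
      "transpose (M ** Y) = M ** Y" "transpose (Y ** M) = Y ** M"
    using X Y by (simp_all add: is_pinv_def)
  have "M ** X = transpose (M ** Y ** (M ** X))"
    by (simp add: matrix_mul_assoc y(1) x(3))
  also have "\<dots> = M ** X ** (M ** Y)"
    by (simp only: matrix_transpose_mul[of "M ** Y" "M ** X"] x(3) y(3))
  also have "\<dots> = M ** Y"
    by (simp add: matrix_mul_assoc x(1))
  finally have MX: "M ** X = M ** Y" .
  have "X ** M = transpose (X ** M ** (Y ** M))"
    by (simp add: y(1) x(4) flip: matrix_mul_assoc)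
      (simp add: y(1) x(4) matrix_mul_assoc)
  also have "\<dots> = Y ** M ** (X ** M)"
    by (simp only: matrix_transpose_mul[of "X ** M" "Y ** M"] x(4) y(4))
  also have "\<dots> = Y ** (M ** X ** M)"
    by (simp add: matrix_mul_assoc)
  finally have XM: "X ** M = Y ** M" by (simp add: x(1))
  have "X = X ** M ** X" by (simp add: x(2))
  also have "\<dots> = Y ** (M ** X)" by (simp add: XM matrix_mul_assoc)
  also have "\<dots> = Y" by (simp add: MX y(2) matrix_mul_assoc)
  finally show ?thesis .
qed

lemma matrix_diff_ldistrib: "A ** (B - C) = A ** B - A ** (C :: real^'n^'m)"
  by (simp add: matrix_eq matrix_vector_mult_diff_rdistrib matrix_vector_mult_diff_distrib
      flip: matrix_vector_mul_assoc)

lemma matrix_diff_rdistrib: "(A - B) ** C = A ** C - B ** (C :: real^'n^'m)"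
  by (simp add: matrix_eq matrix_vector_mult_diff_rdistrib flip: matrix_vector_mul_assoc)

lemma matrix_add_rdistrib: "(A + B) ** C = A ** C + B ** (C :: real^'n^'m)"
  by (simp add: matrix_eq matrix_vector_mult_add_rdistrib flip: matrix_vector_mul_assoc)

lemma transpose_diff: "transpose (A - B) = transpose A - transpose (B :: real^'n^'m)"
  by (simp add: transpose_def vec_eq_iff)

text \<open>With \<open>Q\<close> the orthogonal projection onto the kernel, \<open>M + Q\<close> is invertible and
  the pseudoinverse is \<open>(M + Q)\<^sup>-\<^sup>1 - Q\<close>.\<close>

lemma is_pinv_exists:
  fixes M :: "real^'n^'n"
  assumes sym: "transpose M = M"
  shows "\<exists>X. is_pinv M X"
proof -
  define K where "K = {x. M *v x = 0}"
  have "subspace K"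
    by (auto simp: K_def subspace_def matrix_vector_right_distrib matrix_vector_mult_scaleR)
  then obtain B where B: "B \<subseteq> K" "pairwise orthogonal B" "\<And>x. x \<in> B \<Longrightarrow> norm x = 1"
    "independent B" "span B = K"
    by (metis orthonormal_basis_subspace)
  have finB: "finite B"
    using B(4) independent_bound by blast
  define q where "q = (\<lambda>x. \<Sum>b\<in>B. (b \<bullet> x) *\<^sub>R b)"
  have linq: "linear q"
    unfolding q_def
    by (intro linearI)
      (auto simp: inner_right_distrib scaleR_left_distrib sum.distrib scaleR_sum_right)
  define Q where "Q = matrix q"
  have Q: "Q *v x = q x" for x
    by (simp add: Q_def matrix_works linq)
  have symM: "x \<bullet> (M *v y) = (M *v x) \<bullet> y" for x y
    using sym symmetric_matrix_iff by blast
  have qK: "q x \<in> K" for x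
    unfolding q_def using B(1) \<open>subspace K\<close>
    by (intro subspace_sum) (auto intro: subspace_scale)
  have q_id: "q x = x" if "x \<in> K" for x
  proof -
    have "x \<in> span B" using that B(5) by simp
    then obtain u where u: "x = (\<Sum>b\<in>B. u b *\<^sub>R b)"
      unfolding span_finite[OF finB] by (rule rangeE)
    have orth: "b \<bullet> c = (if b = c then 1 else 0)" if "b \<in> B" "c \<in> B" for b c
      using B(2,3) that by (auto simp: pairwise_def orthogonal_def norm_eq_1)
    have "b \<bullet> x = u b" if "b \<in> B" for b
    proof -
      have "b \<bullet> x = (\<Sum>c\<in>B. u c * (b \<bullet> c))"
        by (simp add: u inner_sum_right)
      also have "\<dots> = (\<Sum>c\<in>B. if b = c then u c else 0)"
        using orth that by (intro sum.cong) auto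
      finally show ?thesis using finB that by simp
    qed
    then show ?thesis by (simp add: q_def u[symmetric])
  qed
  have MQ: "M ** Q = 0"
    using qK by (auto simp: matrix_eq Q K_def simp flip: matrix_vector_mul_assoc)
  have QM: "Q ** M = 0"
  proof -
    \<comment> \<open>Symmetry makes the range of \<open>M\<close> orthogonal to its kernel: the
      inner product of \<open>b\<close> with \<open>M x\<close> is that of \<open>M b = 0\<close>
      with \<open>x\<close>.\<close>
    have "q (M *v x) = 0" for x
      unfolding q_def using B(1) by (intro sum.neutral) (auto simp: symM K_def)
    then show ?thesis
      by (auto simp: matrix_eq Q simp flip: matrix_vector_mul_assoc)
  qed
  have QQ: "Q ** Q = Q"
    using qK q_id by (auto simp: matrix_eq Q simp flip: matrix_vector_mul_assoc)
  have Qsym: "transpose Q = Q"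
    by (auto simp: symmetric_matrix_iff Q q_def inner_sum_right inner_sum_left mult_ac
        inner_commute intro!: sum.cong)
  \<comment> \<open>Applying \<open>Q\<close> annihilates \<open>M x\<close> and leaves
    \<open>q x = 0\<close>. Then \<open>M x = 0\<close> as well, so \<open>x\<close> lies in
    \<open>K\<close> and equals its own projection, which is 0.\<close>
  have "x = 0" if "(M + Q) *v x = 0" for x
  proof -
    have "Q *v ((M + Q) *v x) = Q *v x"
      by (simp add: matrix_vector_mul_assoc matrix_add_ldistrib QM QQ)
    then have "q x = 0" using that by (simp add: Q)
    moreover from this have "x \<in> K"
      using that by (simp add: matrix_vector_mult_add_rdistrib K_def Q)
    ultimately show ?thesis using q_id by metis
  qed
  then obtain N where N: "N ** (M + Q) = mat 1"
    using matrix_left_invertible_ker by blast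
  then have N': "(M + Q) ** N = mat 1"
    using matrix_left_right_inverse by blast
  have NQ: "N ** Q = Q"
  proof -
    have "N ** ((M + Q) ** Q) = N ** Q"
      by (simp add: matrix_add_rdistrib MQ QQ)
    then show ?thesis by (simp add: matrix_mul_assoc N)
  qed
  have QN: "Q ** N = Q"
  proof -
    have "(Q ** (M + Q)) ** N = Q ** N"
      by (simp add: matrix_add_ldistrib QM QQ)
    then show ?thesis by (simp add: N' flip: matrix_mul_assoc)
  qed
  have MX: "M ** (N - Q) = mat 1 - Q"
    using N' by (simp add: matrix_add_rdistrib matrix_diff_ldistrib QN MQ eq_diff_eq)
  have XM: "(N - Q) ** M = mat 1 - Q"
    using N by (simp add: matrix_add_ldistrib matrix_diff_rdistrib NQ QM eq_diff_eq)
  \<comment> \<open>Both products are the symmetric matrix \<open>mat 1 - Q\<close>. The first two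
    Penrose equations reduce to \<open>Q M = 0\<close> and to
    \<open>(mat 1 - Q) (N - Q) = N - Q\<close>.\<close>
  have "is_pinv M (N - Q)"
    unfolding is_pinv_def MX XM
    by (auto simp: matrix_diff_rdistrib matrix_diff_ldistrib QM QN QQ Qsym transpose_diff)
  then show ?thesis ..
qed

text \<open>Transposition exchanges the two symmetry equations. Together with uniqueness this makes
  the pseudoinverse of a symmetric matrix symmetric.\<close>

lemma is_pinv_transpose:
  "is_pinv M X \<Longrightarrow> is_pinv (transpose M) (transpose X)"
  unfolding is_pinv_def by (metis matrix_mul_assoc matrix_transpose_mul transpose_transpose)

lemma pinv_symmetric:
  fixes M :: "real^'n^'n"
  assumes sym: "transpose M = M"
  shows "is_pinv M (pinv M)" "transpose (pinv M) = pinv M"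
proof -
  show *: "is_pinv M (pinv M)"
    unfolding pinv_def using is_pinv_exists[OF sym] is_pinv_unique by (metis theI)
  then show "transpose (pinv M) = pinv M"
    using is_pinv_transpose[of M "pinv M"] sym is_pinv_unique by auto
qed

section \<open>Symmetric positive definite matrices\<close>

lemma sym_pos_def_inner_commute:
  "sym_pos_def M \<Longrightarrow> x \<bullet> (M *v y) = (M *v x) \<bullet> y"
  unfolding sym_pos_def_def by (metis inner_transpose_mult)

lemma sym_pos_def_ker: "sym_pos_def M \<Longrightarrow> M *v x = 0 \<Longrightarrow> x = 0"
  unfolding sym_pos_def_def by force

lemma sym_pos_def_mult_inv:
  assumes "sym_pos_def M"
  shows "M ** matrix_inv M = mat 1"
proof -
  have "invertible M"
    using sym_pos_def_ker[OF assms] invertible_left_inverse matrix_left_invertible_ker by blast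
  then show ?thesis
    unfolding invertible_def matrix_inv_def by (rule someI2_ex) blast
qed

text \<open>The substitution \<open>x = M y\<close> turns the form of the inverse at
  \<open>x\<close> into the form of \<open>M\<close> at \<open>y\<close>.\<close>

lemma sym_pos_def_inv:
  assumes M: "sym_pos_def M"
  shows "sym_pos_def (matrix_inv M)"
proof -
  have inv: "M *v (matrix_inv M *v x) = x" for x
    using sym_pos_def_mult_inv[OF M] by (simp add: matrix_vector_mul_assoc)
  have "x \<bullet> (matrix_inv M *v y) = (matrix_inv M *v x) \<bullet> y" for x y
    by (metis inv sym_pos_def_inner_commute[OF M])
  moreover have "0 < x \<bullet> (matrix_inv M *v x)" if "x \<noteq> 0" for x
  proof -
    have "matrix_inv M *v x \<noteq> 0"
      using inv[of x] that by auto
    then have "0 < (matrix_inv M *v x) \<bullet> (M *v (matrix_inv M *v x))"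
      using M unfolding sym_pos_def_def by blast
    then show ?thesis by (simp add: inv inner_commute)
  qed
  ultimately show ?thesis
    by (simp add: sym_pos_def_def symmetric_matrix_iff)
qed

text \<open>The form at \<open>x\<close> is the form of \<open>V\<close> at \<open>A x\<close>, and
  \<open>A\<close> is injective. With \<open>V\<close> the inverse of \<open>W\<close> this is the
  matrix \<open>B\<close> between the two sketches in \<open>H_mat\<close>.\<close>

lemma sym_pos_def_congruence:
  assumes A: "sym_pos_def A" and V: "sym_pos_def V"
  shows "sym_pos_def (A ** V ** A)"
proof -
  have "x \<bullet> ((A ** V ** A) *v y) = ((A ** V ** A) *v x) \<bullet> y" for x y
    by (simp add: sym_pos_def_inner_commute[OF A] sym_pos_def_inner_commute[OF V]
        flip: matrix_vector_mul_assoc)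
  moreover have "0 < x \<bullet> ((A ** V ** A) *v x)" if "x \<noteq> 0" for x
  proof -
    have "A *v x \<noteq> 0" using sym_pos_def_ker[OF A] that by blast
    then show ?thesis
      using V by (simp add: sym_pos_def_inner_commute[OF A] sym_pos_def_def
          flip: matrix_vector_mul_assoc)
  qed
  ultimately show ?thesis
    by (simp add: sym_pos_def_def symmetric_matrix_iff)
qed

section \<open>Rayleigh quotients and the smallest eigenvalue\<close>

lemma quadratic_form_attains_min:
  fixes M :: "real^'n^'n"
  obtains v where "norm v = 1" "\<And>x. (v \<bullet> (M *v v)) * (norm x)\<^sup>2 \<le> x \<bullet> (M *v x)"
proof -
  have ne: "sphere (0::real^'n) 1 \<noteq> {}" by simp
  have "continuous_on (sphere 0 1) (\<lambda>x. x \<bullet> (M *v x))"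
    by (intro continuous_intros)
  from continuous_attains_inf[OF compact_sphere ne this]
  obtain v where v: "norm v = 1" "\<And>y. norm y = 1 \<Longrightarrow> v \<bullet> (M *v v) \<le> y \<bullet> (M *v y)"
    by (auto simp: sphere_def)
  \<comment> \<open>Both sides are homogeneous of degree 2, so the minimum over the compact unit
    sphere controls the form everywhere.\<close>
  have "(v \<bullet> (M *v v)) * (norm x)\<^sup>2 \<le> x \<bullet> (M *v x)" for x
  proof (cases "x = 0")
    case False
    then have "v \<bullet> (M *v v) \<le> (inverse (norm x) *\<^sub>R x) \<bullet> (M *v (inverse (norm x) *\<^sub>R x))"
      by (intro v(2)) simp
    also have "\<dots> = (x \<bullet> (M *v x)) / (norm x)\<^sup>2"
      by (simp add: matrix_vector_mult_scaleR power2_eq_square divide_inverse)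
    finally show ?thesis using False by (simp add: pos_le_divide_eq)
  qed simp
  with v(1) show ?thesis by (rule that)
qed

text \<open>The minimum of the form over the unit sphere is attained and hence positive. The
  constant later yields a bound on \<open>H_mat A W S\<close> that is uniform in
  \<open>S\<close>.\<close>

lemma sym_pos_def_coercive:
  fixes M :: "real^'n^'n"
  assumes "sym_pos_def M"
  obtains c where "0 < c" "\<And>x. c * (norm x)\<^sup>2 \<le> x \<bullet> (M *v x)"
proof -
  obtain v where v: "norm v = 1" "\<And>x. (v \<bullet> (M *v v)) * (norm x)\<^sup>2 \<le> x \<bullet> (M *v x)"
    using quadratic_form_attains_min by blast
  then have "v \<noteq> 0" by auto
  then have "0 < v \<bullet> (M *v v)"
    using assms by (auto simp: sym_pos_def_def)
  then show ?thesis using that v(2) by blast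
qed

text \<open>One eigenvector per eigenvalue gives a family of pairwise orthogonal nonzero vectors,
  which is independent and so finite. This makes the \<open>Min\<close> in \<open>lambda_min\<close>
  meaningful.\<close>

lemma finite_eigenvalues:
  fixes M :: "real^'n^'n"
  assumes sym: "transpose M = M"
  shows "finite (eigenvalues M)"
proof -
  have "\<forall>l\<in>eigenvalues M. \<exists>v. v \<noteq> 0 \<and> M *v v = l *\<^sub>R v"
    by (simp add: eigenvalues_def)
  then obtain v where v: "\<And>l. l \<in> eigenvalues M \<Longrightarrow> v l \<noteq> 0 \<and> M *v v l = l *\<^sub>R v l"
    by (auto dest!: bchoice)
  have orth: "v l \<bullet> v m = 0" if "l \<in> eigenvalues M" "m \<in> eigenvalues M" "l \<noteq> m" for l m
  proof -
    have "v l \<bullet> (M *v v m) = (M *v v l) \<bullet> v m"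
      using sym symmetric_matrix_iff by blast
    then show ?thesis using that v by simp
  qed
  have "inj_on v (eigenvalues M)"
    by (intro inj_onI) (metis orth v inner_eq_zero_iff)
  moreover have "finite (v ` eigenvalues M)"
  proof -
    have "independent (v ` eigenvalues M)"
      using orth v
      by (intro pairwise_orthogonal_independent) (auto simp: pairwise_def orthogonal_def)
    then show ?thesis using independent_bound by blast
  qed
  ultimately show ?thesis by (simp add: finite_image_iff)
qed

text \<open>A unit vector minimizing the Rayleigh quotient is an eigenvector, since the form
  \<open>M - \<lambda> I\<close> is nonnegative and vanishes there.\<close>

lemma minimal_eigenvalue:
  fixes M :: "real^'n^'n"
  assumes sym: "transpose M = M"
  obtains l where "l \<in> eigenvalues M" "\<And>x. l * (norm x)\<^sup>2 \<le> x \<bullet> (M *v x)"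
proof -
  obtain v where v: "norm v = 1" "\<And>x. (v \<bullet> (M *v v)) * (norm x)\<^sup>2 \<le> x \<bullet> (M *v x)"
    using quadratic_form_attains_min by blast
  define l where "l = v \<bullet> (M *v v)"
  define u where "u = M *v v - l *\<^sub>R v"
  have symM: "x \<bullet> (M *v y) = (M *v x) \<bullet> y" for x y
    using sym symmetric_matrix_iff by blast
  define c where "c = u \<bullet> (M *v u) - l * (u \<bullet> u)"
  \<comment> \<open>This is the form of \<open>M - l I\<close> at \<open>v + t u\<close>. The
    constant term vanishes by the choice of \<open>l\<close>, and the linear coefficient is twice
    the inner product of \<open>u\<close> with the residual of \<open>v\<close>, which is
    \<open>u\<close> itself.\<close>
  have ineq: "0 \<le> 2 * t * (u \<bullet> u) + t\<^sup>2 * c" for t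
  proof -
    have "l * (norm (v + t *\<^sub>R u))\<^sup>2 \<le> (v + t *\<^sub>R u) \<bullet> (M *v (v + t *\<^sub>R u))"
      using v(2) by (simp add: l_def)
    moreover have "v \<bullet> v = 1" using v(1) by (simp add: norm_eq_1)
    moreover have "v \<bullet> (M *v u) = (M *v v) \<bullet> u" "u \<bullet> (M *v v) = (M *v v) \<bullet> u"
      by (rule symM inner_commute)+
    moreover have "(M *v v) \<bullet> u = u \<bullet> u + l * (v \<bullet> u)"
    proof -
      have "M *v v = u + l *\<^sub>R v" by (simp add: u_def)
      then show ?thesis by (simp add: inner_add_left)
    qed
    ultimately show ?thesis
      unfolding power2_norm_eq_inner c_def
      by (simp add: inner_add_left inner_add_right matrix_vector_right_distrib
          matrix_vector_mult_scaleR inner_commute[of u v] l_def[symmetric] algebra_simps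
          power2_eq_square)
  qed
  have "c \<ge> 0"
    using v(2)[of u] by (simp add: c_def l_def power2_norm_eq_inner)
  have "u \<bullet> u = 0"
  proof (rule ccontr)
    assume "u \<bullet> u \<noteq> 0"
    then have pos: "0 < u \<bullet> u" by simp
    \<comment> \<open>Adding 1 keeps the denominator positive when \<open>c = 0\<close>. For this
      \<open>t\<close> the quadratic is at most \<open>t\<close> times the squared norm of
      \<open>u\<close>, which is negative.\<close>
    define d where "d = c + 1"
    define t where "t = - ((u \<bullet> u) / d)"
    have d: "0 < d" using \<open>0 \<le> c\<close> by (simp add: d_def)
    have "2 * t * (u \<bullet> u) + t\<^sup>2 * c \<le> 2 * t * (u \<bullet> u) + t\<^sup>2 * d"
      by (simp add: d_def mult_left_mono)
    also have "\<dots> = t * (2 * (u \<bullet> u) + t * d)"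
      by (simp add: power2_eq_square algebra_simps)
    also have "t * d = - (u \<bullet> u)"
      using d by (simp add: t_def)
    also have "t * (2 * (u \<bullet> u) + - (u \<bullet> u)) < 0"
      using pos d by (simp add: t_def)
    finally show False using ineq[of t] by simp
  qed
  then have "M *v v = l *\<^sub>R v" by (simp add: u_def)
  moreover have "v \<noteq> 0" using v(1) by auto
  ultimately have "l \<in> eigenvalues M" by (auto simp: eigenvalues_def)
  then show ?thesis using that v(2) l_def by blast
qed

lemma lambda_min_le_quadratic_form:
  fixes M :: "real^'n^'n"
  assumes sym: "transpose M = M"
  shows "lambda_min M * (norm x)\<^sup>2 \<le> x \<bullet> (M *v x)"
proof -
  obtain l where l: "l \<in> eigenvalues M" "l * (norm x)\<^sup>2 \<le> x \<bullet> (M *v x)"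
    using minimal_eigenvalue[OF sym] by metis
  have "lambda_min M \<le> l"
    unfolding lambda_min_def using finite_eigenvalues[OF sym] l(1) by (rule Min_le)
  then show ?thesis
    using l(2) by (meson mult_right_mono order_trans zero_le_power2)
qed

lemma lambda_min_nonneg:
  fixes M :: "real^'n^'n"
  assumes sym: "transpose M = M" and psd: "\<And>x. 0 \<le> x \<bullet> (M *v x)"
  shows "0 \<le> lambda_min M"
proof -
  have "lambda_min M \<in> eigenvalues M"
    unfolding lambda_min_def using finite_eigenvalues[OF sym] minimal_eigenvalue[OF sym]
    by (metis Min_in empty_iff)
  then obtain v where "v \<noteq> 0" "M *v v = lambda_min M *\<^sub>R v"
    by (auto simp: eigenvalues_def)
  then show ?thesis
    using psd[of v] by (simp add: zero_le_mult_iff) (metis inner_gt_zero_iff not_less)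
qed

text \<open>Serves the case of a non-integrable \<open>H_mat\<close>, where the expectation takes
  the default value 0.\<close>

lemma lambda_min_zero: "lambda_min (0 :: real^'n^'n) = 0"
proof -
  have "eigenvalues (0 :: real^'n^'n) = {0}"
    using vector_choose_size[of 1] by (auto simp: eigenvalues_def)
  then show ?thesis by (simp add: lambda_min_def)
qed

section \<open>Algebra and uniform bounds of the sketched matrix\<close>

lemma
  fixes A W :: "real^'m^'m"
  assumes A: "sym_pos_def A" and W: "sym_pos_def W"
  shows H_mat_symmetric: "transpose (H_mat A W S) = H_mat A W S"
    and H_mat_reflexive:
      "H_mat A W S ** (A ** matrix_inv W ** A) ** H_mat A W S = H_mat A W S"
proof -
  define B where "B = A ** matrix_inv W ** A"
  have B: "transpose B = B"
    using sym_pos_def_congruence[OF A sym_pos_def_inv[OF W]] by (simp add: B_def sym_pos_def_def)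
  define N where "N = transpose S ** B ** S"
  have H: "H_mat A W S = S ** pinv N ** transpose S"
    by (simp add: H_mat_def N_def B_def matrix_mul_assoc)
  have "transpose N = N"
    by (simp add: N_def matrix_transpose_mul B matrix_mul_assoc)
  then have P: "is_pinv N (pinv N)" "transpose (pinv N) = pinv N"
    by (rule pinv_symmetric)+
  show "transpose (H_mat A W S) = H_mat A W S"
    by (simp add: H matrix_transpose_mul P(2) matrix_mul_assoc)
  \<comment> \<open>The inner factors combine to \<open>N\<close>, so the claim is the second
    Penrose equation for \<open>pinv N\<close>, multiplied by \<open>S\<close> and its
    transpose.\<close>
  have "H_mat A W S ** B ** H_mat A W S = S ** (pinv N ** N ** pinv N) ** transpose S"
    by (simp add: H N_def matrix_mul_assoc)
  then show "H_mat A W S ** (A ** matrix_inv W ** A) ** H_mat A W S = H_mat A W S"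
    using P(1) by (simp add: is_pinv_def H B_def)
qed

lemma H_mat_inner_commute:
  assumes "sym_pos_def A" "sym_pos_def W"
  shows "x \<bullet> (H_mat A W S *v y) = (H_mat A W S *v x) \<bullet> y"
  using H_mat_symmetric[OF assms] symmetric_matrix_iff by blast

text \<open>Insert \<open>H = H B H\<close> and move the left \<open>H\<close> across the inner
  product by symmetry. Nonnegativity, the uniform bound and the norm of the gradient all rest on
  this identity.\<close>

lemma H_mat_quadratic_form:
  assumes A: "sym_pos_def A" and W: "sym_pos_def W"
  shows "x \<bullet> (H_mat A W S *v x) =
    (H_mat A W S *v x) \<bullet> ((A ** matrix_inv W ** A) *v (H_mat A W S *v x))"
  by (metis H_mat_inner_commute[OF A W] H_mat_reflexive[OF A W] matrix_vector_mul_assoc)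

lemma H_mat_psd:
  assumes A: "sym_pos_def A" and W: "sym_pos_def W"
  shows "0 \<le> x \<bullet> (H_mat A W S *v x)"
proof -
  have "sym_pos_def (A ** matrix_inv W ** A)"
    by (intro sym_pos_def_congruence sym_pos_def_inv A W)
  then show ?thesis
    unfolding H_mat_quadratic_form[OF A W, of x] sym_pos_def_def
    by (metis inner_zero_left less_imp_le order_refl)
qed

text \<open>For \<open>y = H x\<close>, coercivity of \<open>B\<close> gives
  \<open>c |y|^2 <= y . B y = x . y <= |x| |y|\<close>, so \<open>1 / c\<close> works for every
  \<open>S\<close>.\<close>

lemma H_mat_bounded:
  assumes A: "sym_pos_def A" and W: "sym_pos_def W"
  obtains C where "0 \<le> C" "\<And>S x. norm (H_mat A W (S :: real^'t^'m) *v x) \<le> C * norm x"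
proof -
  have "sym_pos_def (A ** matrix_inv W ** A)"
    by (intro sym_pos_def_congruence sym_pos_def_inv A W)
  then obtain c where c: "0 < c" "\<And>x. c * (norm x)\<^sup>2 \<le> x \<bullet> ((A ** matrix_inv W ** A) *v x)"
    by (metis sym_pos_def_coercive)
  have "norm (H_mat A W S *v x) \<le> 1 / c * norm x" for S :: "real^'t^'m" and x
  proof (cases "H_mat A W S *v x = 0")
    case True
    then show ?thesis using c by simp
  next
    case False
    have "c * (norm (H_mat A W S *v x))\<^sup>2 \<le> x \<bullet> (H_mat A W S *v x)"
      using c(2) by (simp add: H_mat_quadratic_form[OF A W, of x])
    also have "\<dots> \<le> norm x * norm (H_mat A W S *v x)"
      by (rule norm_cauchy_schwarz)
    finally have "c * norm (H_mat A W S *v x) \<le> norm x"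
      using False by (simp add: power2_eq_square)
    then show ?thesis using c(1) by (simp add: field_simps)
  qed
  then show ?thesis using that[of "1 / c"] c(1) by simp
qed

subsection \<open>Independence of past and present\<close>

lemma borel_measurable_matrix_vector_mult [measurable (raw)]:
  fixes X :: "'a \<Rightarrow> real^'n^'m" and Y :: "'a \<Rightarrow> real^'n"
  assumes "X \<in> borel_measurable M" "Y \<in> borel_measurable M"
  shows "(\<lambda>x. X x *v Y x) \<in> borel_measurable M"
proof -
  have "continuous_on UNIV (\<lambda>p :: (real^'n^'m) \<times> (real^'n). fst p *v snd p)"
    unfolding matrix_vector_mult_def by (intro continuous_intros)
  then have "continuous_on UNIV (\<lambda>p :: (real^'n^'m) \<times> (real^'n). (\<lambda>(X, y). X *v y) p)"
    by (simp add: case_prod_unfold)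
  then show ?thesis
    using borel_measurable_continuous_Pair[OF assms, of "\<lambda>X y. X *v y"]
    by (simp add: case_prod_unfold)
qed

text \<open>Separates the matrix entries from the products of vector entries, so that scalar product
  rules for expectations apply term by term.\<close>

lemma inner_matrix_vector_sum:
  fixes X :: "real^'n^'m"
  shows "x \<bullet> (X *v y) = (\<Sum>i\<in>UNIV. \<Sum>j\<in>UNIV. X $ i $ j * (x $ i * y $ j))"
  by (simp add: inner_vec_def matrix_vector_mult_def sum_distrib_left mult_ac)

lemma integral_matrix_nth:
  fixes X :: "'a \<Rightarrow> real^'n^'m"
  assumes "integrable M X"
  shows "integrable M (\<lambda>x. X x $ i $ j)" "(\<integral>x. X x $ i $ j \<partial>M) = (\<integral>x. X x \<partial>M) $ i $ j"
proof -
  have bl: "bounded_linear (\<lambda>X :: real^'n^'m. X $ i $ j)"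
    using bounded_linear_compose[OF bounded_linear_vec_nth bounded_linear_vec_nth] .
  show "integrable M (\<lambda>x. X x $ i $ j)"
    using integrable_bounded_linear[OF bl assms] .
  show "(\<integral>x. X x $ i $ j \<partial>M) = (\<integral>x. X x \<partial>M) $ i $ j"
    using integral_bounded_linear[OF bl assms] .
qed

lemma inner_integral_matrix:
  fixes X :: "'a \<Rightarrow> real^'n^'m"
  assumes "integrable M X"
  shows "x \<bullet> ((\<integral>s. X s \<partial>M) *v y) = (\<integral>s. x \<bullet> (X s *v y) \<partial>M)"
  unfolding inner_matrix_vector_sum
  by (simp add: integral_matrix_nth[OF assms] Bochner_Integration.integral_sum)

text \<open>The sigma-algebra generated by the samples with index below \<open>n\<close>, encoded as
  the pullback along one map into a product space. For \<open>n = 0\<close> it is trivial.\<close>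

definition past :: "'a measure \<Rightarrow> (nat \<Rightarrow> 'a \<Rightarrow> 'b :: topological_space) \<Rightarrow> nat \<Rightarrow> 'a measure"
  where "past M S n = vimage_algebra (space M) (\<lambda>x. \<lambda>i\<in>{..<n}. S i x) (PiM {..<n} (\<lambda>_. borel))"

lemma space_past [simp]: "space (past M S n) = space M"
  by (simp add: past_def)

lemma measurable_past_sample:
  assumes "i < n"
  shows "S i \<in> past M S n \<rightarrow>\<^sub>M borel"
proof -
  have "(\<lambda>x. \<lambda>i\<in>{..<n}. S i x) \<in> past M S n \<rightarrow>\<^sub>M PiM {..<n} (\<lambda>_. borel)"
    unfolding past_def by (rule measurable_vimage_algebra1) (auto simp: space_PiM)
  from measurable_compose[OF this measurable_component_singleton[of i]] assms
  show ?thesis by simp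
qed

lemma (in prob_space) measurable_past_imp:
  assumes "\<And>i. random_variable borel (S i)" "Y \<in> past M S n \<rightarrow>\<^sub>M N"
  shows "random_variable N Y"
proof -
  have "id \<in> M \<rightarrow>\<^sub>M past M S n"
    unfolding past_def using assms(1)
    by (intro measurable_vimage_algebra2) (auto intro!: measurable_restrict)
  from measurable_comp[OF this assms(2)] show ?thesis by simp
qed

text \<open>The index sets \<open>{n}\<close> and \<open>{..<n}\<close> are disjoint, so the
  sigma-algebras generated by these two blocks are independent. Each of the two variables is
  measurable with respect to one of them.\<close>

lemma (in prob_space) past_indep_var:
  assumes S: "indep_vars (\<lambda>_. borel) S UNIV"
    and Y: "Y \<in> past M S n \<rightarrow>\<^sub>M N" and h: "h \<in> borel \<rightarrow>\<^sub>M L"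
  shows "indep_var L (\<lambda>x. h (S n x)) N Y"
proof -
  let ?R = "\<lambda>A x. \<lambda>i\<in>A. S i x" and ?P = "\<lambda>A. PiM A (\<lambda>_. borel)"
  let ?X = "\<lambda>x. h (S n x)"
  have S': "random_variable borel (S i)" for i
    using S by (auto simp: indep_vars_def)
  have X: "random_variable L ?X"
    using measurable_compose[OF S' h] .
  have "indep_var (?P {n}) (?R {n}) (?P {..<n}) (?R {..<n})"
    by (rule indep_var_restrict[OF S]) auto
  then have ind: "indep_set (sets (vimage_algebra (space M) (?R {n}) (?P {n}))) (sets (past M S n))"
    by (auto simp: indep_var_eq past_def sets_vimage_algebra)
  have "?R {n} \<in> vimage_algebra (space M) (?R {n}) (?P {n}) \<rightarrow>\<^sub>M ?P {n}"
    by (rule measurable_vimage_algebra1) (auto simp: space_PiM)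
  from measurable_compose[OF this measurable_compose[OF measurable_component_singleton[of n "{n}"] h]]
  have "?X \<in> vimage_algebra (space M) (?R {n}) (?P {n}) \<rightarrow>\<^sub>M L"
    by simp
  from measurable_sets[OF this]
  have "{?X -` A \<inter> space M |A. A \<in> sets L} \<subseteq> sets (vimage_algebra (space M) (?R {n}) (?P {n}))"
    by auto
  then have "sigma_sets (space M) {?X -` A \<inter> space M |A. A \<in> sets L}
      \<subseteq> sets (vimage_algebra (space M) (?R {n}) (?P {n}))"
    using sets.sigma_sets_subset[of _ "vimage_algebra (space M) (?R {n}) (?P {n})"] by simp
  moreover have "{Y -` A \<inter> space M |A. A \<in> sets N} \<subseteq> sets (past M S n)"
    using measurable_sets[OF Y] by auto
  then have "sigma_sets (space M) {Y -` A \<inter> space M |A. A \<in> sets N} \<subseteq> sets (past M S n)"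
    using sets.sigma_sets_subset[of _ "past M S n"] by simp
  ultimately show ?thesis
    using X measurable_past_imp[OF S' Y] ind unfolding indep_var_eq indep_sets2_eq by blast
qed

text \<open>Replaces conditioning on the past: each entry of \<open>h (S n x)\<close> is independent
  of each product of two entries of \<open>Y\<close>, so expectations factor in the entrywise sum.
  Boundedness of \<open>Y\<close> supplies integrability.\<close>

lemma (in prob_space) expectation_quadratic_form_past:
  fixes Y :: "'a \<Rightarrow> real^'n" and h :: "'b :: topological_space \<Rightarrow> real^'n^'n"
  assumes S: "indep_vars (\<lambda>_. borel) S UNIV"
    and h: "h \<in> borel_measurable borel" "integrable M (\<lambda>x. h (S n x))"
    and Ym: "Y \<in> borel_measurable (past M S n)"
    and Y: "\<And>x. x \<in> space M \<Longrightarrow> norm (Y x) \<le> C"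
  shows "expectation (\<lambda>x. Y x \<bullet> (h (S n x) *v Y x)) =
    expectation (\<lambda>x. Y x \<bullet> (expectation (\<lambda>x. h (S n x)) *v Y x))"
proof -
  have prod: "(\<lambda>y :: real^'n. y $ i * y $ j) \<in> borel_measurable borel"
    and nth: "(\<lambda>X :: real^'n^'n. X $ i $ j) \<in> borel_measurable borel" for i j
    by (intro borel_measurable_continuous_onI continuous_intros)+
  have S': "random_variable borel (S i)" for i
    using S by (auto simp: indep_vars_def)
  have YY: "(\<lambda>x. Y x $ i * Y x $ j) \<in> borel_measurable (past M S n)" for i j
    using measurable_compose[OF Ym prod] .
  have intY: "integrable M (\<lambda>x. Y x $ i * Y x $ j)" for i j
  proof (rule integrable_const_bound[where B = "C * C"])
    show "AE x in M. norm (Y x $ i * Y x $ j) \<le> C * C"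
    proof (rule AE_I2)
      fix x assume "x \<in> space M"
      then have "\<bar>Y x $ i\<bar> \<le> C" "\<bar>Y x $ j\<bar> \<le> C"
        using Y norm_bound_component_le_cart by blast+
      then show "norm (Y x $ i * Y x $ j) \<le> C * C"
        by (simp add: abs_mult mult_mono')
    qed
    show "(\<lambda>x. Y x $ i * Y x $ j) \<in> borel_measurable M"
      using measurable_past_imp[OF S' YY] .
  qed
  have ind: "indep_var borel (\<lambda>x. h (S n x) $ i $ j) borel (\<lambda>x. Y x $ i * Y x $ j)" for i j
    using past_indep_var[OF S YY measurable_compose[OF h(1) nth]] .
  note XY = indep_var_integrable[OF ind integral_matrix_nth(1)[OF h(2)] intY]
    indep_var_lebesgue_integral[OF ind integral_matrix_nth(1)[OF h(2)] intY]
  show ?thesis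
    unfolding inner_matrix_vector_sum
    by (simp add: XY intY integral_matrix_nth(2)[OF h(2)] Bochner_Integration.integral_sum)
qed

subsection \<open>The iteration\<close>

text \<open>A pathwise inequality for one sample, with \<open>q\<close> equal to twice the loss and
  \<open>w'\<close> in the role of the preceding iterate. Expanding \<open>V\<close> produces a
  cross term between the residuals at \<open>w\<close> and \<open>w'\<close>, which convexity of the
  loss splits.\<close>

lemma energy_step:
  fixes A W :: "real^'m^'m" and S :: "real^'t^'m" and wstar b :: "real^'m"
  defines "V \<equiv> \<lambda>y. (y - wstar) \<bullet> (W *v (y - wstar))"
    and "q \<equiv> \<lambda>y. (A *v y - b) \<bullet> (H_mat A W S *v (A *v y - b))"
  assumes A: "sym_pos_def A" and W: "sym_pos_def W" and wstar: "A *v wstar = b"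
    and "0 \<le> \<eta>" "0 \<le> \<zeta>" and z: "z = w + \<zeta> *\<^sub>R (w - w')"
  shows "V (z - \<eta> *\<^sub>R grad_f A W b S w) + (\<eta> * \<zeta> + 2 * \<eta> - \<eta>\<^sup>2) * q w
    \<le> V z + \<eta> * \<zeta> * q w'"
proof -
  define r where "r = A *v w - b"
  define r' where "r' = A *v w' - b"
  define H where "H = H_mat A W S"
  define g where "g = grad_f A W b S w"
  note symA = sym_pos_def_inner_commute[OF A] and symW = sym_pos_def_inner_commute[OF W]
  have symH: "x \<bullet> (H *v y) = (H *v x) \<bullet> y" for x y
    unfolding H_def by (rule H_mat_inner_commute[OF A W])
  \<comment> \<open>Multiplication by \<open>W\<close> cancels the inverse in the gradient, so only
    Euclidean inner products of residuals with \<open>H r\<close> remain.\<close>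
  have Wg: "W *v g = A *v (H *v r)"
    using sym_pos_def_mult_inv[OF W]
    by (simp add: g_def grad_f_def H_def r_def matrix_vector_mul_assoc matrix_mul_assoc)
  have gWg: "g \<bullet> (W *v g) = r \<bullet> (H *v r)"
  proof -
    have "g = matrix_inv W *v (A *v (H *v r))"
      by (simp add: g_def grad_f_def H_def r_def matrix_vector_mul_assoc matrix_mul_assoc)
    then have "g \<bullet> (W *v g) = (A *v (H *v r)) \<bullet> (matrix_inv W *v (A *v (H *v r)))"
      unfolding Wg by (metis inner_commute)
    also have "\<dots> = (H *v r) \<bullet> ((A ** matrix_inv W ** A) *v (H *v r))"
      by (simp add: symA flip: matrix_vector_mul_assoc)
    finally show ?thesis
      unfolding H_def H_mat_quadratic_form[OF A W, of r] .
  qed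
  have "(z - wstar) \<bullet> (W *v g) = (A *v (z - wstar)) \<bullet> (H *v r)"
    by (simp add: Wg symA)
  also have "A *v (z - wstar) = r + \<zeta> *\<^sub>R (r - r')"
    by (simp add: z r_def r'_def wstar matrix_vector_mult_diff_distrib matrix_vector_right_distrib
        matrix_vector_mult_scaleR)
  also have "(r + \<zeta> *\<^sub>R (r - r')) \<bullet> (H *v r) =
      r \<bullet> (H *v r) + \<zeta> * (r \<bullet> (H *v r) - r' \<bullet> (H *v r))"
    by (simp add: inner_add_left inner_diff_left)
  finally have cross: "(z - wstar) \<bullet> (W *v g) = \<dots>" .
  have "V (z - \<eta> *\<^sub>R g) = V z - 2 * \<eta> * ((z - wstar) \<bullet> (W *v g)) + \<eta>\<^sup>2 * (g \<bullet> (W *v g))"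
  proof -
    define y where "y = z - wstar"
    have y: "z - \<eta> *\<^sub>R g - wstar = y - \<eta> *\<^sub>R g" by (simp add: y_def)
    have "g \<bullet> (W *v y) = y \<bullet> (W *v g)"
      by (metis symW inner_commute)
    then show ?thesis
      unfolding V_def y y_def[symmetric]
      by (simp add: matrix_vector_mult_diff_distrib
          matrix_vector_mult_scaleR inner_diff_left inner_diff_right power2_eq_square algebra_simps)
  qed
  then have V: "V (z - \<eta> *\<^sub>R g) = V z - 2 * \<eta> * q w
      - 2 * (\<eta> * \<zeta>) * (q w - r' \<bullet> (H *v r)) + \<eta>\<^sup>2 * q w"
    unfolding cross gWg by (simp add: q_def r_def H_def algebra_simps)
  \<comment> \<open>Convexity of the loss in the form of nonnegativity at \<open>r - r'\<close>. It
    bounds the mixed term by the mean of \<open>q w\<close> and \<open>q w'\<close>.\<close>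
  have "0 \<le> (r - r') \<bullet> (H *v (r - r'))"
    unfolding H_def by (rule H_mat_psd[OF A W])
  also have "\<dots> = q w + q w' - 2 * (r' \<bullet> (H *v r))"
  proof -
    have "r \<bullet> (H *v r') = r' \<bullet> (H *v r)"
      by (metis symH inner_commute)
    then show ?thesis
      unfolding q_def r_def[symmetric] r'_def[symmetric] H_def[symmetric]
      by (simp add: matrix_vector_mult_diff_distrib inner_diff_left inner_diff_right)
  qed
  finally have "\<eta> * \<zeta> * (2 * (r' \<bullet> (H *v r))) \<le> \<eta> * \<zeta> * (q w + q w')"
    using \<open>0 \<le> \<eta>\<close> \<open>0 \<le> \<zeta>\<close> by (intro mult_left_mono) auto
  then show ?thesis
    unfolding g_def[symmetric] V by (simp add: algebra_simps)
qed

section \<open>Boundedness, measurability and the expected matrix\<close>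

lemma matrix_vector_mult_bounded:
  fixes A :: "real^'n^'m"
  obtains K where "0 \<le> K" "\<And>x. norm (A *v x) \<le> K * norm x"
  using bounded_linear.nonneg_bounded[OF matrix_vector_mul_bounded_linear[of A]]
  by (metis mult.commute)

lemma (in finite_measure) integrable_quadratic_form:
  fixes X :: "'a \<Rightarrow> real^'n^'n"
  assumes [measurable]: "X \<in> borel_measurable M" "Y \<in> borel_measurable M"
    and X: "\<And>x y. norm (X x *v y) \<le> K * norm y" and "0 \<le> K"
    and Y: "\<And>x. x \<in> space M \<Longrightarrow> norm (Y x) \<le> C"
  shows "integrable M (\<lambda>x. Y x \<bullet> (X x *v Y x))"
proof (rule integrable_const_bound[where B = "C * (K * C)"])
  show "AE x in M. norm (Y x \<bullet> (X x *v Y x)) \<le> C * (K * C)"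
  proof (rule AE_I2)
    fix x assume "x \<in> space M"
    have C: "0 \<le> C" using Y[OF \<open>x \<in> space M\<close>] norm_ge_zero order_trans by blast
    have "norm (Y x \<bullet> (X x *v Y x)) \<le> norm (Y x) * norm (X x *v Y x)"
      by (simp add: Cauchy_Schwarz_ineq2)
    also have "\<dots> \<le> C * (K * C)"
      using X[of x "Y x"] Y[OF \<open>x \<in> space M\<close>] C \<open>0 \<le> K\<close>
      by (intro mult_mono) (auto intro: order_trans mult_left_mono)
    finally show "norm (Y x \<bullet> (X x *v Y x)) \<le> C * (K * C)" .
  qed
qed measurable

text \<open>Affine growth in \<open>w\<close>, uniform in the sample, lets boundedness pass from one
  iterate to the next.\<close>

lemma grad_f_bounded:
  fixes A W :: "real^'m^'m"
  assumes A: "sym_pos_def A" and W: "sym_pos_def W"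
  obtains K where "0 \<le> K"
    "\<And>S w. norm (grad_f A W b (S :: real^'t^'m) w) \<le> K * (norm w + 1)"
proof -
  obtain C where C: "0 \<le> C" "\<And>S x. norm (H_mat A W (S :: real^'t^'m) *v x) \<le> C * norm x"
    using H_mat_bounded[OF A W] by blast
  obtain K1 where K1: "0 \<le> K1" "\<And>x. norm (A *v x) \<le> K1 * norm x"
    using matrix_vector_mult_bounded by blast
  obtain K2 where K2: "0 \<le> K2" "\<And>x. norm ((matrix_inv W ** A) *v x) \<le> K2 * norm x"
    using matrix_vector_mult_bounded by blast
  define K where "K = K2 * (C * (K1 + norm b))"
  have "norm (grad_f A W b S w) \<le> K * (norm w + 1)" for S :: "real^'t^'m" and w
  proof -
    have "norm (A *v w - b) \<le> norm (A *v w) + norm b"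
      by (rule norm_triangle_ineq4)
    also have "\<dots> \<le> K1 * norm w + norm b"
      using K1(2) by simp
    also have "\<dots> \<le> (K1 + norm b) * (norm w + 1)"
      using K1(1) by (simp add: algebra_simps)
    finally have r: "norm (A *v w - b) \<le> (K1 + norm b) * (norm w + 1)" .
    have "norm (grad_f A W b S w) \<le> K2 * norm (H_mat A W S *v (A *v w - b))"
      using K2(2)[of "H_mat A W S *v (A *v w - b)"]
      by (simp add: grad_f_def matrix_vector_mul_assoc)
    also have "\<dots> \<le> K2 * (C * norm (A *v w - b))"
      using C(2) K2(1) by (intro mult_left_mono) auto
    also have "\<dots> \<le> K2 * (C * ((K1 + norm b) * (norm w + 1)))"
      using C(1) K2(1) r by (intro mult_left_mono) auto
    finally show ?thesis by (simp add: K_def mult.assoc)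
  qed
  moreover have "0 \<le> K" using C(1) K1(1) K2(1) by (simp add: K_def)
  ultimately show ?thesis using that by blast
qed

text \<open>Measurability of \<open>H_mat A W\<close> enters as an assumption, which integrability
  over \<open>D\<close> will supply. The measure \<open>M\<close> is arbitrary so that it can be a
  \<open>past\<close>.\<close>

lemma borel_measurable_grad_f:
  fixes A W :: "real^'m^'m" and S :: "'a \<Rightarrow> real^'t^'m"
  assumes [measurable]: "H_mat A W \<in> borel_measurable (borel :: (real^'t^'m) measure)" "S \<in> borel_measurable M"
    "Y \<in> borel_measurable M"
  shows "(\<lambda>x. grad_f A W b (S x) (Y x)) \<in> borel_measurable M"
proof -
  have [measurable]: "(\<lambda>x. H_mat A W (S x)) \<in> borel_measurable M"
    using measurable_compose[OF assms(2,1)] .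
  show ?thesis
    unfolding grad_f_def matrix_vector_mul_assoc[symmetric] by measurable
qed

text \<open>Integration commutes with each bilinear form, so both properties pass from the samples
  to the mean.\<close>

lemma H_mat_expectation:
  fixes A W :: "real^'m^'m" and D :: "(real^'t^'m) measure"
  assumes A: "sym_pos_def A" and W: "sym_pos_def W" and int: "integrable D (H_mat A W)"
  shows expected_H_symmetric: "transpose (expected_H A W D) = expected_H A W D"
    and expected_H_psd: "0 \<le> x \<bullet> (expected_H A W D *v x)"
proof -
  show "transpose (expected_H A W D) = expected_H A W D"
    unfolding symmetric_matrix_iff
  proof (intro allI)
    fix x y
    have "x \<bullet> (expected_H A W D *v y) = y \<bullet> (expected_H A W D *v x)"
      unfolding expected_H_def inner_integral_matrix[OF int]
      by (simp add: H_mat_inner_commute[OF A W, of x] inner_commute)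
    then show "x \<bullet> (expected_H A W D *v y) = (expected_H A W D *v x) \<bullet> y"
      by (simp add: inner_commute)
  qed
  show "0 \<le> x \<bullet> (expected_H A W D *v x)"
    unfolding expected_H_def inner_integral_matrix[OF int]
    by (intro Bochner_Integration.integral_nonneg H_mat_psd[OF A W])
qed

text \<open>The integrable case, with indices made natural: \<open>z j\<close> stands for z^(j-1).
  The bound is kept as a product, which makes sense even if \<open>lambda_min\<close>
  vanishes.\<close>

lemma (in prob_space) sketch_momentum_bound:
  fixes A W :: "real^'m^'m" and S :: "nat \<Rightarrow> 'a \<Rightarrow> real^'t^'m"
    and w z :: "nat \<Rightarrow> 'a \<Rightarrow> real^'m" and \<eta> \<zeta> :: "nat \<Rightarrow> real"
  defines "s \<equiv> \<lambda>k. \<Sum>t<k. \<eta> t * (1 - \<eta> t)"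
  assumes A: "sym_pos_def A" and W: "sym_pos_def W" and wstar: "A *v wstar = b"
    and S: "indep_vars (\<lambda>_. borel) S UNIV" and D: "\<And>j. distr M borel (S j) = D"
    and int: "integrable D (H_mat A W)"
    and eta: "\<And>j. 0 < \<eta> j" "\<And>j. \<eta> j < 1"
    and zeta: "\<And>j. \<eta> j * \<zeta> j = s j"
    and init: "\<And>x. x \<in> space M \<Longrightarrow> w 0 x = w0" "\<And>x. x \<in> space M \<Longrightarrow> z 0 x = w0"
    and z_step: "\<And>j x. x \<in> space M \<Longrightarrow>
      z (Suc j) x = z j x - \<eta> j *\<^sub>R grad_f A W b (S j x) (w j x)"
    and w_step: "\<And>j x. x \<in> space M \<Longrightarrow>
      w (Suc j) x = (1 - 1 / (\<zeta> (Suc j) + 1)) *\<^sub>R w j x + (1 / (\<zeta> (Suc j) + 1)) *\<^sub>R z (Suc j) x"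
  shows "integrable M (\<lambda>x. (norm (A *v w k x - b))\<^sup>2)"
    and "lambda_min (expected_H A W D) * expectation (\<lambda>x. (norm (A *v w k x - b))\<^sup>2) * s (Suc k)
      \<le> (wnorm W (w0 - wstar))\<^sup>2"
proof -
  have [measurable]: "random_variable borel (S j)" for j
    using S by (auto simp: indep_vars_def)
  \<comment> \<open>Integrable functions are measurable, and \<open>D\<close> carries the Borel sets
    because it is a distribution on \<open>borel\<close>.\<close>
  have Hm [measurable]: "H_mat A W \<in> borel_measurable (borel :: (real^'t^'m) measure)"
    using int D[of 0, symmetric] by (auto dest: borel_measurable_integrable)
  have intH: "integrable M (\<lambda>x. H_mat A W (S j x))"
    and EH: "expectation (\<lambda>x. H_mat A W (S j x)) = expected_H A W D" for j
  proof -
    show "integrable M (\<lambda>x. H_mat A W (S j x))"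
      using int unfolding D[of j, symmetric] by (subst (asm) integrable_distr_eq) auto
    show "expectation (\<lambda>x. H_mat A W (S j x)) = expected_H A W D"
      unfolding expected_H_def D[of j, symmetric] by (subst integral_distr) auto
  qed
  define E where "E = expected_H A W D"
  have s_nonneg: "0 \<le> s j" for j
    unfolding s_def using eta by (intro sum_nonneg mult_nonneg_nonneg) (auto intro: less_imp_le)
  have zeta_nonneg: "0 \<le> \<zeta> j" for j
    using s_nonneg[of j] eta(1)[of j] zeta[of j] by (metis zero_le_mult_iff not_less)

  \<comment> \<open>The \<open>k\<close>-th iterates are functions of the samples with index below
    \<open>k\<close>. The induction runs inside a fixed \<open>past M S n\<close>, where step
    \<open>k\<close> may use \<open>S k\<close> because \<open>k < n\<close>.\<close>
  have meas: "w k \<in> borel_measurable (past M S n) \<and> z k \<in> borel_measurable (past M S n)"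
    if "k \<le> n" for k n
    using that
  proof (induction k)
    case 0
    have "w 0 \<in> borel_measurable (past M S n) \<longleftrightarrow> (\<lambda>_. w0) \<in> borel_measurable (past M S n)"
      "z 0 \<in> borel_measurable (past M S n) \<longleftrightarrow> (\<lambda>_. w0) \<in> borel_measurable (past M S n)"
      by (rule measurable_cong; simp add: init)+
    then show ?case by simp
  next
    case (Suc k)
    then have [measurable]: "w k \<in> borel_measurable (past M S n)" "z k \<in> borel_measurable (past M S n)"
      "S k \<in> borel_measurable (past M S n)"
      by (auto intro: measurable_past_sample)
    note [measurable] = borel_measurable_grad_f[OF Hm]
    have "z (Suc k) \<in> borel_measurable (past M S n) \<longleftrightarrow>
      (\<lambda>x. z k x - \<eta> k *\<^sub>R grad_f A W b (S k x) (w k x)) \<in> borel_measurable (past M S n)"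
      by (rule measurable_cong) (simp add: z_step)
    then have [measurable]: "z (Suc k) \<in> borel_measurable (past M S n)" by simp
    have "w (Suc k) \<in> borel_measurable (past M S n) \<longleftrightarrow>
      (\<lambda>x. (1 - 1 / (\<zeta> (Suc k) + 1)) *\<^sub>R w k x + (1 / (\<zeta> (Suc k) + 1)) *\<^sub>R z (Suc k) x)
        \<in> borel_measurable (past M S n)"
      by (rule measurable_cong) (simp add: w_step)
    then show ?case by simp
  qed
  have [measurable]: "w k \<in> borel_measurable M" "z k \<in> borel_measurable M" for k
    using meas[of k k] measurable_past_imp[of S] by auto

  obtain K where K: "0 \<le> K"
    "\<And>S w. norm (grad_f A W b (S :: real^'t^'m) w) \<le> K * (norm w + 1)"
    using grad_f_bounded[OF A W] by blast
  \<comment> \<open>The bound may depend on \<open>k\<close>, which suffices for integrability. The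
    new \<open>w\<close> is a convex combination, as \<open>\<zeta>\<close> is nonnegative.\<close>
  have bound: "\<exists>C. \<forall>x\<in>space M. norm (w k x) \<le> C \<and> norm (z k x) \<le> C" for k
  proof (induction k)
    case 0
    then show ?case using init by auto
  next
    case (Suc k)
    then obtain C where C: "\<And>x. x \<in> space M \<Longrightarrow> norm (w k x) \<le> C"
      "\<And>x. x \<in> space M \<Longrightarrow> norm (z k x) \<le> C"
      by blast
    define c where "c = 1 / (\<zeta> (Suc k) + 1)"
    have c: "0 \<le> c" "c \<le> 1"
      using zeta_nonneg[of "Suc k"] by (auto simp: c_def)
    define C' where "C' = C + \<eta> k * (K * (C + 1))"
    have z': "norm (z (Suc k) x) \<le> C'" if x: "x \<in> space M" for x
    proof -
      have "norm (z (Suc k) x) \<le> norm (z k x) + \<eta> k * norm (grad_f A W b (S k x) (w k x))"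
        unfolding z_step[OF x] using norm_triangle_ineq4[of "z k x"] eta(1)[of k]
        by (metis abs_of_pos norm_scaleR)
      also have "norm (grad_f A W b (S k x) (w k x)) \<le> K * (C + 1)"
        using K(2)[of "S k x" "w k x"] C(1)[OF x] K(1)
        by (meson add_right_mono mult_left_mono order_trans)
      finally show ?thesis
        using C(2)[OF x] eta(1)[of k] by (simp add: C'_def mult_left_mono)
    qed
    have w': "norm (w (Suc k) x) \<le> max C C'" if x: "x \<in> space M" for x
    proof -
      have "w (Suc k) x = (1 - c) *\<^sub>R w k x + c *\<^sub>R z (Suc k) x"
        unfolding c_def by (rule w_step[OF x])
      then have "norm (w (Suc k) x) \<le> (1 - c) * norm (w k x) + c * norm (z (Suc k) x)"
        using norm_triangle_ineq[of "(1 - c) *\<^sub>R w k x" "c *\<^sub>R z (Suc k) x"] c by simp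
      also have "\<dots> \<le> (1 - c) * max C C' + c * max C C'"
        using C(1)[OF x] z'[OF x] c by (intro add_mono mult_left_mono) auto
      finally show ?thesis by (simp add: algebra_simps)
    qed
    show ?case using z' w' by (intro exI[of _ "max C C'"]) (force simp: le_max_iff_disj)
  qed

  define r where "r = (\<lambda>k x. A *v w k x - b)"
  have r_meas [measurable]: "r k \<in> borel_measurable M" for k
    unfolding r_def by measurable
  have r_past: "r k \<in> borel_measurable (past M S n)" if "k \<le> n" for k n
  proof -
    have [measurable]: "w k \<in> borel_measurable (past M S n)" using meas[OF that] by blast
    show ?thesis unfolding r_def by measurable
  qed
  have r_bound: "\<exists>C. \<forall>x\<in>space M. norm (r k x) \<le> C" for k
  proof -
    obtain K1 where K1: "0 \<le> K1" "\<And>x. norm (A *v x) \<le> K1 * norm x"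
      using matrix_vector_mult_bounded by blast
    obtain C where C: "\<And>x. x \<in> space M \<Longrightarrow> norm (w k x) \<le> C"
      using bound[of k] by blast
    have "norm (r k x) \<le> K1 * C + norm b" if "x \<in> space M" for x
    proof -
      have "norm (r k x) \<le> norm (A *v w k x) + norm b"
        unfolding r_def by (rule norm_triangle_ineq4)
      also have "norm (A *v w k x) \<le> K1 * C"
        using K1 C[OF that] by (meson mult_left_mono order_trans)
      finally show ?thesis by simp
    qed
    then show ?thesis by blast
  qed

  define V where "V = (\<lambda>y. (y - wstar) \<bullet> (W *v (y - wstar)))"
  define Q where "Q = (\<lambda>k. expectation (\<lambda>x. r k x \<bullet> (E *v r k x)))"
  define q where "q = (\<lambda>j k x. r k x \<bullet> (H_mat A W (S j x) *v r k x))"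
  have q_int: "integrable M (q j k)" for j k
  proof -
    obtain C where "\<And>x. x \<in> space M \<Longrightarrow> norm (r k x) \<le> C" using r_bound by blast
    moreover obtain K where "0 \<le> K"
      "\<And>S x. norm (H_mat A W (S :: real^'t^'m) *v x) \<le> K * norm x"
      using H_mat_bounded[OF A W] by blast
    ultimately show ?thesis
      unfolding q_def by (intro integrable_quadratic_form[where K = K and C = C]) auto
  qed
  \<comment> \<open>For \<open>k \<le> j\<close> the residual depends only on samples before
    \<open>j\<close>. The case \<open>k < j\<close> is used too, since the energy inequality
    evaluates the current sample at the preceding iterate.\<close>
  have q_exp: "expectation (q j k) = Q k" if "k \<le> j" for j k
  proof -
    obtain C where "\<And>x. x \<in> space M \<Longrightarrow> norm (r k x) \<le> C" using r_bound by blast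
    from expectation_quadratic_form_past[OF S Hm intH r_past[OF that] this]
    show ?thesis by (simp add: q_def Q_def E_def EH)
  qed
  have quad_int: "integrable M (\<lambda>x. r k x \<bullet> (N *v r k x))" for k and N :: "real^'m^'m"
  proof -
    obtain C where "\<And>x. x \<in> space M \<Longrightarrow> norm (r k x) \<le> C" using r_bound by blast
    moreover obtain K where "0 \<le> K" "\<And>x. norm (N *v x) \<le> K * norm x"
      using matrix_vector_mult_bounded by blast
    ultimately show ?thesis
      by (intro integrable_quadratic_form[where K = K and C = C]) auto
  qed
  have V_int: "integrable M (\<lambda>x. V (z k x))" for k
  proof -
    obtain C where C: "\<And>x. x \<in> space M \<Longrightarrow> norm (z k x) \<le> C" using bound by blast
    obtain K where "0 \<le> K" "\<And>x. norm (W *v x) \<le> K * norm x"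
      using matrix_vector_mult_bounded by blast
    moreover have "norm (z k x - wstar) \<le> C + norm wstar" if "x \<in> space M" for x
      using norm_triangle_ineq4[of "z k x" wstar] C[OF that] by simp
    ultimately show ?thesis
      unfolding V_def by (intro integrable_quadratic_form[where K = K and C = "C + norm wstar"]) auto
  qed
  have V_nonneg: "0 \<le> V y" for y
    using W unfolding V_def sym_pos_def_def by (metis inner_zero_left less_imp_le order_refl)
  have Q_nonneg: "0 \<le> Q k" for k
    unfolding Q_def E_def
    by (intro Bochner_Integration.integral_nonneg expected_H_psd[OF A W int])

  \<comment> \<open>The averaging step solved for the \<open>z\<close> iterate, in the form that the
    energy inequality expects.\<close>
  have rel: "z (Suc k) x = w (Suc k) x + \<zeta> (Suc k) *\<^sub>R (w (Suc k) x - w k x)"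
    if x: "x \<in> space M" for k x
  proof -
    have "\<zeta> (Suc k) + 1 \<noteq> 0" using zeta_nonneg[of "Suc k"] by simp
    moreover from this have "(\<zeta> (Suc k) + 1) *\<^sub>R w (Suc k) x = \<zeta> (Suc k) *\<^sub>R w k x + z (Suc k) x"
      unfolding w_step[OF x] by (simp add: scaleR_add_right right_diff_distrib)
    ultimately show ?thesis by (simp add: algebra_simps)
  qed
  \<comment> \<open>Here \<open>l\<close> is the index of the preceding iterate. At
    \<open>k = 0\<close> it is taken as 0, reflecting w^(-1) = w^0.\<close>
  have step: "expectation (\<lambda>x. V (z (Suc k) x)) + s (Suc k) * Q k
      \<le> expectation (\<lambda>x. V (z k x)) + s k * Q l"
    if l: "l \<le> k" and rel: "\<And>x. x \<in> space M \<Longrightarrow> z k x = w k x + \<zeta> k *\<^sub>R (w k x - w l x)" for k l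
  proof -
    have "V (z (Suc k) x) + (s k + 2 * \<eta> k - (\<eta> k)\<^sup>2) * q k k x \<le> V (z k x) + s k * q k l x"
      if x: "x \<in> space M" for x
      using energy_step[OF A W wstar less_imp_le[OF eta(1)[of k]] zeta_nonneg rel[OF x], of "S k x"]
      unfolding V_def q_def r_def z_step[OF x] zeta .
    then have "expectation (\<lambda>x. V (z (Suc k) x) + (s k + 2 * \<eta> k - (\<eta> k)\<^sup>2) * q k k x)
        \<le> expectation (\<lambda>x. V (z k x) + s k * q k l x)"
      by (intro integral_mono) (auto intro!: V_int q_int)
    then have "expectation (\<lambda>x. V (z (Suc k) x)) + (s k + 2 * \<eta> k - (\<eta> k)\<^sup>2) * Q k
        \<le> expectation (\<lambda>x. V (z k x)) + s k * Q l"
      using l by (simp add: V_int q_int q_exp)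
    \<comment> \<open>The coefficient on the right exceeds \<open>s (Suc k)\<close> by exactly
      \<open>\<eta> k\<close>, and this surplus is dropped.\<close>
    moreover have "s (Suc k) * Q k \<le> (s k + 2 * \<eta> k - (\<eta> k)\<^sup>2) * Q k"
      using eta(1)[of k]
      by (intro mult_right_mono Q_nonneg) (simp add: s_def power2_eq_square algebra_simps)
    ultimately show ?thesis by simp
  qed
  \<comment> \<open>The term \<open>s k * Q l\<close> left over from one step is the one carried by
    the step before, so the estimates chain down to \<open>s 0 = 0\<close>.\<close>
  have energy: "expectation (\<lambda>x. V (z (Suc k) x)) + s (Suc k) * Q k \<le> V w0" for k
  proof (induction k)
    case 0
    have "s 0 = 0" by (simp add: s_def)
    moreover have "expectation (\<lambda>x. V (z 0 x)) = V w0"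
      using init(2) by (simp add: prob_space cong: Bochner_Integration.integral_cong)
    moreover have "expectation (\<lambda>x. V (z (Suc 0) x)) + s (Suc 0) * Q 0
      \<le> expectation (\<lambda>x. V (z 0 x)) + s 0 * Q 0"
      by (rule step) (simp_all add: init)
    ultimately show ?case by simp
  next
    case (Suc k)
    have "expectation (\<lambda>x. V (z (Suc (Suc k)) x)) + s (Suc (Suc k)) * Q (Suc k)
      \<le> expectation (\<lambda>x. V (z (Suc k) x)) + s (Suc k) * Q k"
      by (rule step) (simp_all add: rel)
    then show ?case using Suc by simp
  qed
  have norm_int: "integrable M (\<lambda>x. (norm (r k x))\<^sup>2)" for k
    using quad_int[of k "mat 1"] by (simp add: power2_norm_eq_inner)
  then show "integrable M (\<lambda>x. (norm (A *v w k x - b))\<^sup>2)"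
    by (simp add: r_def)
  have "lambda_min E * expectation (\<lambda>x. (norm (r k x))\<^sup>2) =
      expectation (\<lambda>x. lambda_min E * (norm (r k x))\<^sup>2)"
    by simp
  also have "\<dots> \<le> Q k"
    unfolding Q_def E_def
    by (intro integral_mono integrable_mult_right norm_int quad_int lambda_min_le_quadratic_form
        expected_H_symmetric[OF A W int])
  finally have "lambda_min E * expectation (\<lambda>x. (norm (r k x))\<^sup>2) * s (Suc k) \<le> s (Suc k) * Q k"
    by (subst mult.commute) (intro mult_left_mono s_nonneg)
  also have "\<dots> \<le> V w0"
  proof -
    \<comment> \<open>The distance term in the energy is nonnegative and is discarded, leaving the
      weighted residual.\<close>
    have "0 \<le> expectation (\<lambda>x. V (z (Suc k) x))"
      by (intro Bochner_Integration.integral_nonneg V_nonneg)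
    then show ?thesis using energy[of k] by linarith
  qed
  also have "V w0 = (wnorm W (w0 - wstar))\<^sup>2"
    using V_nonneg[of w0] by (simp add: V_def wnorm_def)
  finally show "lambda_min (expected_H A W D) * expectation (\<lambda>x. (norm (A *v w k x - b))\<^sup>2) * s (Suc k)
      \<le> (wnorm W (w0 - wstar))\<^sup>2"
    by (simp add: E_def r_def)
qed

theorem theorem6p2:
  fixes A W :: "real^'m^'m"
    and b wstar w0 :: "real^'m"
    and D :: "(real^'t^'m) measure"
    and M :: "'a measure"
    and S :: "nat \<Rightarrow> 'a \<Rightarrow> real^'t^'m"
    and \<eta> \<zeta> :: "nat \<Rightarrow> real"
    and w z :: "int \<Rightarrow> 'a \<Rightarrow> real^'m"
    and k :: nat
  assumes A: "sym_pos_def A"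
    and W: "sym_pos_def W"
    and wstar: "A *v wstar = b"
    and D: "prob_space D" "sets D = sets borel"
    and M: "prob_space M"
    and S_indep: "prob_space.indep_vars M (\<lambda>_. borel) S UNIV"
    and S_distr: "\<And>j. distr M borel (S j) = D"
    and eta: "\<And>j. 0 < \<eta> j" "\<And>j. \<eta> j < 1"
    and zeta_0: "\<zeta> 0 = 0"
    and zeta: "\<And>j. j \<ge> 1 \<Longrightarrow> \<zeta> j = 1 / \<eta> j * (\<Sum>t=0..j-1. \<eta> t * (1 - \<eta> t))"
    and w_init: "\<And>x. x \<in> space M \<Longrightarrow> w 0 x = w0" "\<And>x. x \<in> space M \<Longrightarrow> w (-1) x = w0"
    and z_init: "\<And>x. x \<in> space M \<Longrightarrow> z (-1) x = w0"
    and z_step: "\<And>j x. x \<in> space M \<Longrightarrow>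
      z (int j) x = z (int j - 1) x - \<eta> j *\<^sub>R grad_f A W b (S j x) (w (int j) x)"
    and w_step: "\<And>j x. x \<in> space M \<Longrightarrow>
      w (int j + 1) x = (1 - 1 / (\<zeta> (j + 1) + 1)) *\<^sub>R w (int j) x
        + (1 / (\<zeta> (j + 1) + 1)) *\<^sub>R z (int j) x"
  shows "(\<integral>\<^sup>+x. ennreal ((norm (A *v w (int k) x - b))\<^sup>2) \<partial>M)
    \<le> (if lambda_min (expected_H A W D) = 0 then \<infinity>
       else ennreal (1 / lambda_min (expected_H A W D) *
              ((wnorm W (w0 - wstar))\<^sup>2 / (\<Sum>t=0..k. \<eta> t * (1 - \<eta> t)))))"
proof (cases "integrable D (H_mat A W)")
  case False
  \<comment> \<open>The Bochner integral of a non-integrable function is 0 by convention, which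
    selects the infinite branch of the bound.\<close>
  then have "lambda_min (expected_H A W D) = 0"
    by (simp add: expected_H_def not_integrable_integral_eq lambda_min_zero)
  then show ?thesis by simp
next
  case True
  interpret prob_space M by (rule M)
  define l where "l = lambda_min (expected_H A W D)"
  define s where "s = (\<Sum>t<Suc k. \<eta> t * (1 - \<eta> t))"
  define e where "e = expectation (\<lambda>x. (norm (A *v w (int k) x - b))\<^sup>2)"
  have zeta': "\<eta> j * \<zeta> j = (\<Sum>t<j. \<eta> t * (1 - \<eta> t))" for j
  proof (cases j)
    case 0
    then show ?thesis by (simp add: zeta_0)
  next
    case (Suc i)
    then show ?thesis
      using zeta[of j] eta(1)[of j] by (simp add: atLeast0AtMost lessThan_Suc_atMost)
  qed
  have w': "w (int (Suc j)) x = (1 - 1 / (\<zeta> (Suc j) + 1)) *\<^sub>R w (int j) x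
      + (1 / (\<zeta> (Suc j) + 1)) *\<^sub>R z (int (Suc j) - 1) x" if "x \<in> space M" for j x
    using w_step[OF that, of j] by (simp add: add.commute)
  \<comment> \<open>The shift \<open>int j - 1\<close> sends the natural index 0 to the initial
    value z^(-1).\<close>
  note bound = sketch_momentum_bound[where w = "\<lambda>j. w (int j)" and z = "\<lambda>j. z (int j - 1)"
      and \<eta> = \<eta> and \<zeta> = \<zeta> and k = k, OF A W wstar S_indep S_distr True eta zeta']
  have int: "integrable M (\<lambda>x. (norm (A *v w (int k) x - b))\<^sup>2)"
    by (rule bound(1)) (use w_init z_init z_step w' in auto)
  have main: "l * e * s \<le> (wnorm W (w0 - wstar))\<^sup>2"
    unfolding l_def e_def s_def
    by (rule bound(2)) (use w_init z_init z_step w' in auto)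
  have "0 < s"
    unfolding s_def using eta by (intro sum_pos mult_pos_pos) auto
  have "0 \<le> l"
    unfolding l_def using expected_H_symmetric[OF A W True] expected_H_psd[OF A W True]
    by (rule lambda_min_nonneg)
  \<comment> \<open>Nonnegativity of \<open>l\<close> turns \<open>l \<noteq> 0\<close> into
    positivity, so the product bound may be divided by \<open>l\<close> and
    \<open>s\<close>.\<close>
  have "e \<le> 1 / l * ((wnorm W (w0 - wstar))\<^sup>2 / s)" if "l \<noteq> 0"
    using main \<open>0 < s\<close> \<open>0 \<le> l\<close> that by (simp add: field_simps)
  moreover have "(\<integral>\<^sup>+x. ennreal ((norm (A *v w (int k) x - b))\<^sup>2) \<partial>M) = ennreal e"
    unfolding e_def by (intro nn_integral_eq_integral int) simp
  moreover have "(\<Sum>t=0..k. \<eta> t * (1 - \<eta> t)) = s"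
    by (simp only: s_def atLeast0AtMost lessThan_Suc_atMost)
  ultimately show ?thesis
    by (auto simp: l_def[symmetric] intro: ennreal_leI)
qed

end
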